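(* Let $S$ be a regular AG-groupoid with left identity and let $A=(\mu_A,\gamma_A)$ be an intuitionistic fuzzy set of $S$. Then $A$ is an intuitionistic fuzzy left ideal of $S$ if and only if $A$ is an intuitionistic fuzzy bi-ideal of $S$.
   Context: An AG-groupoid is a non-empty set $S$ with a binary operation satisfying the left invertive law $(ab)c=(cb)a$ for all $a,b,c\in S$ (no associativity is assumed). A left identity is an element $e\in S$ with $ea=a$ for all $a\in S$. $S$ is regular if for every $a\in S$ there is $x\in S$ with $a=(ax)a$. An intuitionistic fuzzy set (IFS) of $S$ is a pair $A=(\mu_A,\gamma_A)$ of functions $\mu_A,\gamma_A:S\to[0,1]$ with $0\le \mu_A(x)+\gamma_A(x)\le 1$ for all $x\in S$. An IFS $A$ is an intuitionistic fuzzy left ideal if $\mu_A(xy)\ge\mu_A(y)$ and $\gamma_A(xy)\le\gamma_A(y)$ for all $x,y\in S$. It is an intuitionistic fuzzy AG-subgroupoid if $\mu_A(xy)\ge\min\{\mu_A(x),\mu_A(y)\}$ and $\gamma_A(xy)\le\max\{\gamma_A(x),\gamma_A(y)\}$ for all $x,y\in S$. An intuitionistic fuzzy bi-ideal is an intuitionistic fuzzy AG-subgroupoid with $\mu_A((xa)y)\ge\min\{\mu_A(x),\mu_A(y)\}$ and $\gamma_A((xa)y)\le\max\{\gamma_A(x),\gamma_A(y)\}$ for all $x,a,y\in S$. *)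

theory Defs
  imports Complex_Main
begin

locale ag_groupoid =
  fixes S :: "'a set" and mult :: "'a \<Rightarrow> 'a \<Rightarrow> 'a" (infixl "\<cdot>" 70)
  assumes nonempty: "S \<noteq> {}"
    and closed: "\<lbrakk>a \<in> S; b \<in> S\<rbrakk> \<Longrightarrow> a \<cdot> b \<in> S"
    and left_invertive: "\<lbrakk>a \<in> S; b \<in> S; c \<in> S\<rbrakk> \<Longrightarrow> (a \<cdot> b) \<cdot> c = (c \<cdot> b) \<cdot> a"

definition left_identity :: "'a set \<Rightarrow> ('a \<Rightarrow> 'a \<Rightarrow> 'a) \<Rightarrow> 'a \<Rightarrow> bool" where
  "left_identity S mult e \<longleftrightarrow> e \<in> S \<and> (\<forall>a\<in>S. mult e a = a)"

definition regular :: "'a set \<Rightarrow> ('a \<Rightarrow> 'a \<Rightarrow> 'a) \<Rightarrow> bool" where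
  "regular S mult \<longleftrightarrow> (\<forall>a\<in>S. \<exists>x\<in>S. a = mult (mult a x) a)"

text \<open>
  An intuitionistic fuzzy set is a pair of a membership function and a non-membership
  function. Both are total functions on the ambient type; every notion below looks only at
  their values on the carrier \<open>S\<close>.
\<close>

type_synonym 'a ifs = "('a \<Rightarrow> real) \<times> ('a \<Rightarrow> real)"

abbreviation membership :: "'a ifs \<Rightarrow> 'a \<Rightarrow> real" ("\<mu>") where
  "\<mu> A \<equiv> fst A"

abbreviation nonmembership :: "'a ifs \<Rightarrow> 'a \<Rightarrow> real" ("\<gamma>") where
  "\<gamma> A \<equiv> snd A"

definition intuitionistic_fuzzy_set :: "'a set \<Rightarrow> 'a ifs \<Rightarrow> bool" where
  "intuitionistic_fuzzy_set S A \<longleftrightarrow>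
     (\<forall>x\<in>S. \<mu> A x \<in> {0..1} \<and> \<gamma> A x \<in> {0..1} \<and>
            0 \<le> \<mu> A x + \<gamma> A x \<and> \<mu> A x + \<gamma> A x \<le> 1)"

definition if_left_ideal :: "'a set \<Rightarrow> ('a \<Rightarrow> 'a \<Rightarrow> 'a) \<Rightarrow> 'a ifs \<Rightarrow> bool" where
  "if_left_ideal S mult A \<longleftrightarrow> intuitionistic_fuzzy_set S A \<and>
     (\<forall>x\<in>S. \<forall>y\<in>S. \<mu> A (mult x y) \<ge> \<mu> A y \<and> \<gamma> A (mult x y) \<le> \<gamma> A y)"

definition if_ag_subgroupoid :: "'a set \<Rightarrow> ('a \<Rightarrow> 'a \<Rightarrow> 'a) \<Rightarrow> 'a ifs \<Rightarrow> bool" where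
  "if_ag_subgroupoid S mult A \<longleftrightarrow> intuitionistic_fuzzy_set S A \<and>
     (\<forall>x\<in>S. \<forall>y\<in>S. \<mu> A (mult x y) \<ge> min (\<mu> A x) (\<mu> A y) \<and>
                    \<gamma> A (mult x y) \<le> max (\<gamma> A x) (\<gamma> A y))"

definition if_bi_ideal :: "'a set \<Rightarrow> ('a \<Rightarrow> 'a \<Rightarrow> 'a) \<Rightarrow> 'a ifs \<Rightarrow> bool" where
  "if_bi_ideal S mult A \<longleftrightarrow> if_ag_subgroupoid S mult A \<and>
     (\<forall>x\<in>S. \<forall>a\<in>S. \<forall>y\<in>S. \<mu> A (mult (mult x a) y) \<ge> min (\<mu> A x) (\<mu> A y) \<and>
                           \<gamma> A (mult (mult x a) y) \<le> max (\<gamma> A x) (\<gamma> A y))"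

end

theory Submission
  imports Defs
begin

text \<open>
  The operation \<open>a \<circ> b = (ae)b\<close> makes \<open>S\<close> a commutative monoid on which \<open>a \<mapsto> ae\<close> is an
  involutive automorphism, and in this monoid regularity says that \<open>b\<close> is a multiple of
  \<open>b \<circ> b\<close>. So every multiple of \<open>b\<close> is already of the form \<open>b \<circ> t \<circ> b\<close>; translated back,
  \<open>b = (bx)b\<close> gives \<open>ab = (b((ae)x))b\<close>, to which the bi-ideal condition applies.
\<close>

context ag_groupoid
begin

lemma medial:
  assumes "a \<in> S" "b \<in> S" "c \<in> S" "d \<in> S"
  shows "(a \<cdot> b) \<cdot> (c \<cdot> d) = (a \<cdot> c) \<cdot> (b \<cdot> d)"
proof -
  have "(a \<cdot> b) \<cdot> (c \<cdot> d) = ((c \<cdot> d) \<cdot> b) \<cdot> a"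
    using assms by (intro left_invertive closed)
  also have "\<dots> = ((b \<cdot> d) \<cdot> c) \<cdot> a"
    using assms by (simp add: left_invertive[of c d b])
  also have "\<dots> = (a \<cdot> c) \<cdot> (b \<cdot> d)"
    using assms by (intro left_invertive closed)
  finally show ?thesis .
qed

text \<open>The medial law with \<open>e\<close> in the first slot: the left identity disappears
  from both sides.\<close>

lemma left_commute:
  assumes e: "left_identity S (\<cdot>) e" and "a \<in> S" "b \<in> S" "c \<in> S"
  shows "a \<cdot> (b \<cdot> c) = b \<cdot> (a \<cdot> c)"
  using medial[of e a b c] assms unfolding left_identity_def by simp

lemma regular_mult_eq:
  assumes e: "left_identity S (\<cdot>) e"
    and a: "a \<in> S" and b: "b \<in> S" and x: "x \<in> S"
    and bx: "b = (b \<cdot> x) \<cdot> b"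
  shows "a \<cdot> b = (b \<cdot> ((a \<cdot> e) \<cdot> x)) \<cdot> b"
proof -
  have eS: "e \<in> S" and id: "\<And>s. s \<in> S \<Longrightarrow> e \<cdot> s = s"
    using e by (auto simp: left_identity_def)
  \<comment> \<open>Multiplying regularity on the right by \<open>e\<close> lets the left invertive
    law exchange \<open>e\<close> with \<open>b \<cdot> x\<close>, after which \<open>e\<close> is
    absorbed.\<close>
  have "b \<cdot> e = ((b \<cdot> x) \<cdot> b) \<cdot> e"
    by (rule arg_cong[OF bx, of "\<lambda>s. s \<cdot> e"])
  also have "\<dots> = b \<cdot> (b \<cdot> x)"
    using left_invertive[of "b \<cdot> x" b e] b x eS by (simp add: closed id)
  finally have be: "b \<cdot> (b \<cdot> x) = b \<cdot> e" by simp
  \<comment> \<open>Moving \<open>a \<cdot> e\<close> to the front allows the next exchange to form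
    \<open>b \<cdot> (b \<cdot> x)\<close>, which \<open>be\<close> then rids of
    \<open>x\<close>.\<close>
  have "(b \<cdot> ((a \<cdot> e) \<cdot> x)) \<cdot> b = ((a \<cdot> e) \<cdot> (b \<cdot> x)) \<cdot> b"
    using left_commute[OF e, of b "a \<cdot> e" x] a b x eS by (simp add: closed)
  also have "\<dots> = (b \<cdot> (b \<cdot> x)) \<cdot> (a \<cdot> e)"
    using a b x eS by (intro left_invertive closed)
  also have "\<dots> = ((a \<cdot> e) \<cdot> e) \<cdot> b"
    unfolding be using a b eS by (intro left_invertive closed)
  \<comment> \<open>Right multiplication by \<open>e\<close> is an involution:
    \<open>(a \<cdot> e) \<cdot> e = (e \<cdot> e) \<cdot> a = a\<close>. This is why the witness
    carries \<open>a \<cdot> e\<close> instead of \<open>a\<close>.\<close>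
  also have "\<dots> = a \<cdot> b"
    using left_invertive[of a e e] a eS by (simp add: id)
  finally show ?thesis by simp
qed

end

text \<open>Both products are left multiples of \<open>y\<close>, and the value at \<open>y\<close>
  alone already bounds the min from above and the max from below.\<close>

lemma if_left_ideal_imp_bi_ideal:
  assumes "ag_groupoid S mult" and A: "if_left_ideal S mult A"
  shows "if_bi_ideal S mult A"
proof -
  interpret ag_groupoid S mult by fact
  show ?thesis
    using A unfolding if_left_ideal_def if_bi_ideal_def if_ag_subgroupoid_def
    by (auto simp: closed min_le_iff_disj le_max_iff_disj)
qed

lemma if_bi_ideal_imp_left_ideal:
  assumes "ag_groupoid S mult" and reg: "regular S mult"
    and e: "left_identity S mult e" and A: "if_bi_ideal S mult A"
  shows "if_left_ideal S mult A"
proof -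
  interpret ag_groupoid S mult by fact
  have "\<mu> A b \<le> \<mu> A (mult a b) \<and> \<gamma> A (mult a b) \<le> \<gamma> A b" if a: "a \<in> S" and b: "b \<in> S" for a b
  proof -
    obtain x where x: "x \<in> S" and bx: "b = mult (mult b x) b"
      using reg b unfolding regular_def by blast
    have "mult (mult a e) x \<in> S"
      using a x e by (simp add: closed left_identity_def)
    then obtain c where "c \<in> S" and "mult a b = mult (mult b c) b"
      using regular_mult_eq[OF e a b x bx] by blast
    \<comment> \<open>Both outer factors are \<open>b\<close>, so the min and max in the bi-ideal
      condition collapse to the value at \<open>b\<close>.\<close>
    then show ?thesis
      using A b unfolding if_bi_ideal_def by (metis max.idem min.idem)
  qed
  then show ?thesis
    using A unfolding if_left_ideal_def if_bi_ideal_def if_ag_subgroupoid_def by blast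
qed

theorem theorem4:
  fixes S :: "'a set" and mult :: "'a \<Rightarrow> 'a \<Rightarrow> 'a" and A :: "'a ifs"
  assumes "ag_groupoid S mult"
    and "regular S mult"
    and "\<exists>e. left_identity S mult e"
    and "intuitionistic_fuzzy_set S A"
  shows "if_left_ideal S mult A \<longleftrightarrow> if_bi_ideal S mult A"
  using if_left_ideal_imp_bi_ideal[OF assms(1)] if_bi_ideal_imp_left_ideal[OF assms(1,2)] assms(3)
  by metis

end
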